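(* Let $S$ be a semigroup and let $E\subseteq S$ be a subset of idempotents such that $\widetilde{\mathcal L}_E$ is a right congruence. Then for every $e\in E$ the group $G_e$ acts on the right of $\widetilde{\mathcal L}_E(e)$ by right multiplication.
   Context: For a subset $E$ of idempotents of a semigroup $S$, the equivalence relation $\widetilde{\mathcal L}_E$ is defined by: $a\,\widetilde{\mathcal L}_E\,b$ iff for all $e\in E$ ($ae=a\Leftrightarrow be=b$). $\widetilde{\mathcal L}_E(e)$ is the $\widetilde{\mathcal L}_E$-class of $e$. $G_e$ is the Green $\mathcal H$-class of the idempotent $e$, i.e. the maximal subgroup of $S$ with identity $e$. *)

theory Defs
  imports "HOL-Algebra.Group"
begin

definition principal_left_ideal :: "'a::semigroup_mult \<Rightarrow> 'a set" where
  "principal_left_ideal a = insert a {s * a | s. True}"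

definition principal_right_ideal :: "'a::semigroup_mult \<Rightarrow> 'a set" where
  "principal_right_ideal a = insert a {a * s | s. True}"

definition green_L :: "'a::semigroup_mult \<Rightarrow> 'a \<Rightarrow> bool" where
  "green_L a b \<longleftrightarrow> principal_left_ideal a = principal_left_ideal b"

definition green_R :: "'a::semigroup_mult \<Rightarrow> 'a \<Rightarrow> bool" where
  "green_R a b \<longleftrightarrow> principal_right_ideal a = principal_right_ideal b"

definition green_H :: "'a::semigroup_mult \<Rightarrow> 'a \<Rightarrow> bool" where
  "green_H a b \<longleftrightarrow> green_L a b \<and> green_R a b"

text \<open>The H-class of \<open>e\<close> with the multiplication of the ambient semigroup and unit \<open>e\<close>.
  It is a group only when \<open>e\<close> is idempotent.\<close>

definition max_subgroup :: "'a::semigroup_mult \<Rightarrow> 'a monoid" where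
  "max_subgroup e = \<lparr>carrier = {a. green_H a e}, mult = (*), one = e\<rparr>"

definition tilde_L :: "'a::semigroup_mult set \<Rightarrow> 'a \<Rightarrow> 'a \<Rightarrow> bool" where
  "tilde_L E a b \<longleftrightarrow> (\<forall>e\<in>E. a * e = a \<longleftrightarrow> b * e = b)"

definition tilde_L_class :: "'a::semigroup_mult set \<Rightarrow> 'a \<Rightarrow> 'a set" where
  "tilde_L_class E a = {b. tilde_L E a b}"

definition right_congruence :: "('a::semigroup_mult \<Rightarrow> 'a \<Rightarrow> bool) \<Rightarrow> bool" where
  "right_congruence R \<longleftrightarrow> equivp R \<and> (\<forall>a b c. R a b \<longrightarrow> R (a * c) (b * c))"

text \<open>\<open>group_action\<close> of HOL-Algebra is a left action. The argument order
  of \<open>act\<close> is point first, group element second.\<close>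

locale right_group_action = group G for G (structure) +
  fixes X :: "'x set" and act :: "'x \<Rightarrow> 'a \<Rightarrow> 'x"
  assumes act_closed: "\<lbrakk>x \<in> X; g \<in> carrier G\<rbrakk> \<Longrightarrow> act x g \<in> X"
    and act_one: "x \<in> X \<Longrightarrow> act x \<one> = x"
    and act_mult: "\<lbrakk>x \<in> X; g \<in> carrier G; h \<in> carrier G\<rbrakk>
      \<Longrightarrow> act x (g \<otimes> h) = act (act x g) h"

end

theory Submission
  imports Defs
begin

text \<open>Only invariance of the class needs an argument. If x is \<open>tilde_L\<close>-related
  to e and g lies in the H-class of e, right congruence relates x * g to e * g = g. Since L is
  contained in \<open>tilde_L\<close> (\<open>green_L_imp_tilde_L\<close>), g is related to e, hence
  so is x * g. The group structure comes from \<open>green_H_idempotent_iff\<close>: the H-class of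
  e is the group of units of the local monoid eSe.\<close>

text \<open>The inserted generator accounts for the possibility a = e; idempotence then writes e as
  the multiple e * e, so no adjoined identity is needed.\<close>

lemma green_L_idempotent_iff:
  fixes a e :: "'a::semigroup_mult"
  assumes "e * e = e"
  shows "green_L a e \<longleftrightarrow> a * e = a \<and> (\<exists>u. u * a = e)"
proof
  assume "green_L a e"
  then have "a \<in> principal_left_ideal e" "e \<in> principal_left_ideal a"
    by (auto simp: green_L_def principal_left_ideal_def)
  then show "a * e = a \<and> (\<exists>u. u * a = e)"
    unfolding principal_left_ideal_def using assms by (auto; metis mult.assoc)
next
  assume "a * e = a \<and> (\<exists>u. u * a = e)"
  then obtain u where "a = a * e" "e = u * a" by metis
  then show "green_L a e"
    unfolding green_L_def principal_left_ideal_def by (auto; metis mult.assoc)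
qed

lemma green_R_idempotent_iff:
  fixes a e :: "'a::semigroup_mult"
  assumes "e * e = e"
  shows "green_R a e \<longleftrightarrow> e * a = a \<and> (\<exists>v. a * v = e)"
proof
  assume "green_R a e"
  then have "a \<in> principal_right_ideal e" "e \<in> principal_right_ideal a"
    by (auto simp: green_R_def principal_right_ideal_def)
  then show "e * a = a \<and> (\<exists>v. a * v = e)"
    unfolding principal_right_ideal_def using assms by (auto; metis mult.assoc)
next
  assume "e * a = a \<and> (\<exists>v. a * v = e)"
  then obtain v where "a = e * a" "e = a * v" by metis
  then show "green_R a e"
    unfolding green_R_def principal_right_ideal_def by (auto; metis mult.assoc)
qed

text \<open>L gives a left inverse of a relative to e and R a right inverse. Inside eSe the two
  merge into one two-sided inverse.\<close>

lemma green_H_idempotent_iff: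
  fixes a e :: "'a::semigroup_mult"
  assumes "e * e = e"
  shows "green_H a e \<longleftrightarrow>
    a * e = a \<and> e * a = a \<and> (\<exists>i. i * e = i \<and> e * i = i \<and> i * a = e \<and> a * i = e)"
    (is "_ \<longleftrightarrow> ?unit")
proof
  assume "green_H a e"
  then obtain u v where ae: "a * e = a" and ea: "e * a = a" and ua: "u * a = e" and av: "a * v = e"
    using assms by (auto simp: green_H_def green_L_idempotent_iff green_R_idempotent_iff)
  \<comment> \<open>The left inverse u need not lie in eSe; multiplying by e on both sides moves it
    there.\<close>
  let ?i = "e * u * e"
  have "?i * e = ?i" "e * ?i = ?i" "?i * a = e"
    using assms ea ua by (simp_all add: mult.assoc) (simp flip: mult.assoc add: assms)
  moreover have "a * ?i = e"
  proof -
    \<comment> \<open>The outer e is absorbed by a, and the last e is replaced by a * v; then u * a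
      collapses to e.\<close>
    have "a * ?i = a * (u * a) * v"
      using ae av by (simp flip: mult.assoc) (simp add: mult.assoc)
    then show ?thesis using ua ae av by simp
  qed
  ultimately show ?unit using ae ea by blast
next
  assume ?unit
  then show "green_H a e"
    using assms by (auto simp: green_H_def green_L_idempotent_iff green_R_idempotent_iff)
qed

lemma group_max_subgroup:
  fixes e :: "'a::semigroup_mult"
  assumes e: "e * e = e"
  shows "group (max_subgroup e)"
proof (rule groupI)
  fix a b assume "a \<in> carrier (max_subgroup e)" "b \<in> carrier (max_subgroup e)"
  then obtain i j where a: "a * e = a" "e * a = a" "i * e = i" "e * i = i" "i * a = e" "a * i = e"
    and b: "b * e = b" "e * b = b" "j * e = j" "e * j = j" "j * b = e" "b * j = e"
    by (auto simp: max_subgroup_def green_H_idempotent_iff[OF e])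
  \<comment> \<open>The inverse of a product is the product of inverses in reverse order; regrouping
    makes the inner pair cancel to e.\<close>
  have "(j * i) * (a * b) = j * (i * a) * b" "(a * b) * (j * i) = a * (b * j) * i"
    by (simp_all only: mult.assoc)
  then have "(j * i) * (a * b) = e" "(a * b) * (j * i) = e"
    using a b by simp_all
  moreover have "(a * b) * e = a * b" "(j * i) * e = j * i"
    using a b by (simp_all add: mult.assoc)
  moreover have "e * (a * b) = a * b" "e * (j * i) = j * i"
    using a b by (simp_all flip: mult.assoc)
  ultimately show "a \<otimes>\<^bsub>max_subgroup e\<^esub> b \<in> carrier (max_subgroup e)"
    by (auto simp: max_subgroup_def green_H_idempotent_iff[OF e])
next
  fix a assume "a \<in> carrier (max_subgroup e)"
  then show "\<exists>b\<in>carrier (max_subgroup e). b \<otimes>\<^bsub>max_subgroup e\<^esub> a = \<one>\<^bsub>max_subgroup e\<^esub>"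
    by (auto simp: max_subgroup_def green_H_idempotent_iff[OF e])
qed (use e in \<open>auto simp: max_subgroup_def green_H_idempotent_iff mult.assoc\<close>)

text \<open>With a = a * e and e = u * a, a right identity f of e fixes a = a * e, and one of a
  fixes e = u * a.\<close>

lemma green_L_imp_tilde_L:
  fixes a e :: "'a::semigroup_mult"
  assumes "e * e = e" "green_L a e"
  shows "tilde_L E e a"
proof -
  obtain u where "a * e = a" "u * a = e"
    using assms by (auto simp: green_L_idempotent_iff)
  then show ?thesis
    unfolding tilde_L_def by (metis mult.assoc)
qed

theorem lemma5p5:
  fixes E :: "'a::semigroup_mult set"
  assumes "\<And>e. e \<in> E \<Longrightarrow> e * e = e"
    and "right_congruence (tilde_L E)"
  shows "\<forall>e\<in>E. right_group_action (max_subgroup e) (tilde_L_class E e) (\<lambda>x g. x * g)"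
proof
  fix e assume "e \<in> E"
  then have e: "e * e = e" by (rule assms(1))
  interpret group "max_subgroup e" by (rule group_max_subgroup[OF e])
  show "right_group_action (max_subgroup e) (tilde_L_class E e) (\<lambda>x g. x * g)"
  proof
    fix x g
    assume "x \<in> tilde_L_class E e" and "g \<in> carrier (max_subgroup e)"
    then have x: "tilde_L E e x" and g: "green_H g e"
      by (simp_all add: tilde_L_class_def max_subgroup_def)
    have "tilde_L E (e * g) (x * g)"
      using assms(2) x by (simp add: right_congruence_def)
    moreover have "e * g = g"
      using g by (simp add: green_H_idempotent_iff[OF e])
    moreover have "tilde_L E e g"
      using e g by (simp add: green_H_def green_L_imp_tilde_L)
    ultimately show "x * g \<in> tilde_L_class E e"
      by (simp add: tilde_L_class_def tilde_L_def)
  next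
    fix x assume "x \<in> tilde_L_class E e"
    \<comment> \<open>As e itself belongs to E, the relation may be tested at e, where e * e = e
      forces x * e = x.\<close>
    then show "x * \<one>\<^bsub>max_subgroup e\<^esub> = x"
      using \<open>e \<in> E\<close> e by (simp add: tilde_L_class_def tilde_L_def max_subgroup_def)
  qed (simp add: max_subgroup_def mult.assoc)
qed

end
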